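(* Let $m\ge2$ be the degree of the splines. For all integers $p\ge m$ and every knot sequence $T$, the infinite norm of the spline discrete quasi-interpolant $Q_{p,2}^*$ (defined in the context) satisfies $$\|Q_{p,2}^*\|_\infty\le\frac{m+1}{m-1}.$$ In particular the operators $Q_{p,2}^*$ are uniformly bounded, by a bound independent of $p$ and of the sequence of knots $T$.
   Context: Let $T=\{t_i\}_{i\in\mathbb{Z}}$ be a strictly increasing sequence of knots partitioning $\mathbb{R}$ (so $t_i\to\pm\infty$ as $i\to\pm\infty$). For $i\in\mathbb{Z}$, $B_i$ is the B-spline of degree $m$ with support $[t_{i-m},t_{i+1}]$, i.e. with knots $t_{i-m},\dots,t_{i+1}$, normalized so that $\sum_{i\in\mathbb{Z}}B_i=1$. Let $\theta_i=\frac1m\sum_{r=0}^{m-1}t_{i-r}$ and $\theta_i^{(2)}=\binom m2^{-1}\sum_{0\le r<s\le m-1}t_{i-r}t_{i-s}$. For $i\in\mathbb{Z}$ let $(\lambda_i^*(-p),\lambda_i^*(0),\lambda_i^*(p))$ be the unique solution of the $3\times3$ Vandermonde system $$\lambda_i^*(-p)+\lambda_i^*(0)+\lambda_i^*(p)=1,$$ $$\theta_{i-p}\lambda_i^*(-p)+\theta_i\lambda_i^*(0)+\theta_{i+p}\lambda_i^*(p)=\theta_i,$$ $$\theta_{i-p}^2\lambda_i^*(-p)+\theta_i^2\lambda_i^*(0)+\theta_{i+p}^2\lambda_i^*(p)=\theta_i^{(2)}.$$ The operator $Q_{p,2}^*$ is $$Q_{p,2}^*f=\sum_{i\in\mathbb{Z}}\mu_i^*(f)B_i,\qquad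 \mu_i^*(f)=\lambda_i^*(-p)f(\theta_{i-p})+\lambda_i^*(0)f(\theta_i)+\lambda_i^*(p)f(\theta_{i+p}).$$ $\|Q\|_\infty$ denotes the operator norm with respect to the sup norm on $\mathbb{R}$, i.e. the supremum of $\|Qf\|_\infty$ over bounded continuous $f$ on $\mathbb{R}$ with $\|f\|_\infty\le1$. *)

theory Defs
  imports "HOL-Analysis.Analysis"
begin

definition knot_sequence :: "(int \<Rightarrow> real) \<Rightarrow> bool" where
  "knot_sequence t \<longleftrightarrow>
     strict_mono t \<and> filterlim t at_top at_top \<and> filterlim t at_bot at_bot"

text \<open>
  Cox--de Boor recursion. The index is that of the last but one knot: \<open>bspline t m i\<close> has
  degree \<open>m\<close> and knots \<open>t (i - m), \<dots>, t (i + 1)\<close>. That this is the normalization with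
  sum 1 is \<open>bspline_partition_of_unity\<close> below.
\<close>

fun bspline :: "(int \<Rightarrow> real) \<Rightarrow> nat \<Rightarrow> int \<Rightarrow> real \<Rightarrow> real" where
  "bspline t 0 i x = (if t i \<le> x \<and> x < t (i + 1) then 1 else 0)"
| "bspline t (Suc k) i x =
     (x - t (i - int (Suc k))) / (t i - t (i - int (Suc k))) * bspline t k (i - 1) x +
     (t (i + 1) - x) / (t (i + 1) - t (i - int k)) * bspline t k i x"

definition theta :: "(int \<Rightarrow> real) \<Rightarrow> nat \<Rightarrow> int \<Rightarrow> real" where
  "theta t m i = (\<Sum>r<m. t (i - int r)) / real m"

definition theta2 :: "(int \<Rightarrow> real) \<Rightarrow> nat \<Rightarrow> int \<Rightarrow> real" where
  "theta2 t m i =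
     (\<Sum>s<m. \<Sum>r<s. t (i - int r) * t (i - int s)) / real (m choose 2)"

text \<open>
  The triple consists of the coefficients attached to \<open>-p\<close>, \<open>0\<close> and \<open>p\<close>, in this order.
  The description is proper by \<open>lambda_system_ex1\<close> below.
\<close>

definition lambda_system ::
  "(int \<Rightarrow> real) \<Rightarrow> nat \<Rightarrow> int \<Rightarrow> int \<Rightarrow> real \<times> real \<times> real \<Rightarrow> bool" where
  "lambda_system t m p i = (\<lambda>(a, b, c).
     a + b + c = 1 \<and>
     theta t m (i - p) * a + theta t m i * b + theta t m (i + p) * c = theta t m i \<and>
     (theta t m (i - p))\<^sup>2 * a + (theta t m i)\<^sup>2 * b + (theta t m (i + p))\<^sup>2 * c
       = theta2 t m i)"

definition lambda_star ::
  "(int \<Rightarrow> real) \<Rightarrow> nat \<Rightarrow> int \<Rightarrow> int \<Rightarrow> real \<times> real \<times> real" where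
  "lambda_star t m p i = (THE l. lambda_system t m p i l)"

definition mu_star ::
  "(int \<Rightarrow> real) \<Rightarrow> nat \<Rightarrow> int \<Rightarrow> int \<Rightarrow> (real \<Rightarrow> real) \<Rightarrow> real" where
  "mu_star t m p i f = (case lambda_star t m p i of (a, b, c) \<Rightarrow>
     a * f (theta t m (i - p)) + b * f (theta t m i) + c * f (theta t m (i + p)))"

definition Q_star ::
  "(int \<Rightarrow> real) \<Rightarrow> nat \<Rightarrow> int \<Rightarrow> (real \<Rightarrow> real) \<Rightarrow> real \<Rightarrow> real" where
  "Q_star t m p f x = (\<Sum>\<^sub>\<infinity>i. mu_star t m p i f * bspline t m i x)"

text \<open>
  Both suprema are taken in the extended reals, so that an unbounded function or operator
  has norm \<open>\<infinity>\<close>.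
\<close>

definition sup_norm :: "(real \<Rightarrow> real) \<Rightarrow> ereal" where
  "sup_norm f = (SUP x. ereal \<bar>f x\<bar>)"

definition op_sup_norm :: "((real \<Rightarrow> real) \<Rightarrow> real \<Rightarrow> real) \<Rightarrow> ereal" where
  "op_sup_norm Q =
     (SUP f \<in> {f. continuous_on UNIV f \<and> bounded (range f) \<and> sup_norm f \<le> 1}.
        sup_norm (Q f))"

lemma knot_interval_ex:
  assumes "knot_sequence t"
  shows "\<exists>j. t j \<le> x \<and> x < t (j + 1)"
proof -
  have sm: "strict_mono t" and up: "filterlim t at_top at_top" and dn: "filterlim t at_bot at_bot"
    using assms by (auto simp: knot_sequence_def)
  obtain u where u: "x < t u"
    using up unfolding filterlim_at_top_dense eventually_at_top_linorder by blast
  obtain l where l: "t l \<le> x"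
    using dn unfolding filterlim_at_bot eventually_at_bot_linorder by blast
  have "l < u" using l u sm by (meson order_le_less_trans strict_mono_less)
  have "\<exists>j. t j \<le> x \<and> x < t (j + 1)" if "x < t (l + int n)" for n
    using that
  proof (induction n)
    case 0
    then show ?case using l by simp
  next
    case (Suc n)
    show ?case
    proof (cases "x < t (l + int n)")
      case True
      then show ?thesis using Suc.IH by blast
    next
      case False
      have "l + int (Suc n) = l + int n + 1" by simp
      then show ?thesis using False Suc.prems by (metis not_less)
    qed
  qed
  from this[of "nat (u - l)"] show ?thesis using u \<open>l < u\<close> by simp
qed

lemma bspline_0_eq:
  assumes "strict_mono t" "t j \<le> x" "x < t (j + 1)"
  shows "bspline t 0 i x = (if i = j then 1 else 0)"
proof -
  have "i = j" if "t i \<le> x" "x < t (i + 1)"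
  proof -
    have "t i < t (j + 1)" "t j < t (i + 1)" using assms that by linarith+
    then have "i < j + 1" "j < i + 1" using assms(1) by (simp_all add: strict_mono_less)
    then show ?thesis by simp
  qed
  then have "t i \<le> x \<and> x < t (i + 1) \<longleftrightarrow> i = j" using assms(2,3) by blast
  then show ?thesis by (simp only: bspline.simps)
qed

lemma finite_bspline_support:
  assumes "knot_sequence t"
  shows "finite {i. bspline t m i x \<noteq> 0}"
proof (induction m)
  case 0
  obtain j where j: "t j \<le> x" "x < t (j + 1)" using knot_interval_ex[OF assms] by blast
  have "strict_mono t" using assms by (simp add: knot_sequence_def)
  then have "{i. bspline t 0 i x \<noteq> 0} \<subseteq> {j}" 
    using bspline_0_eq[OF _ j] by (auto simp del: bspline.simps)
  then show ?case using finite_subset by blast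
next
  case (Suc k)
  let ?F = "{i. bspline t k i x \<noteq> 0}"
  have "{i. bspline t (Suc k) i x \<noteq> 0} \<subseteq> ?F \<union> (\<lambda>i. i + 1) ` ?F"
  proof
    fix i assume "i \<in> {i. bspline t (Suc k) i x \<noteq> 0}"
    then have "bspline t k (i - 1) x \<noteq> 0 \<or> bspline t k i x \<noteq> 0" by auto
    moreover have "i = (i - 1) + 1" by simp
    ultimately show "i \<in> ?F \<union> (\<lambda>i. i + 1) ` ?F" by blast
  qed
  then show ?case using Suc finite_subset by blast
qed

lemma bspline_partition_of_unity:
  assumes "knot_sequence t"
  shows "((\<lambda>i. bspline t m i x) has_sum 1) UNIV"
proof (induction m)
  case 0
  obtain j where j: "t j \<le> x" "x < t (j + 1)" using knot_interval_ex[OF assms] by blast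
  have "strict_mono t" using assms by (simp add: knot_sequence_def)
  then have eq: "bspline t 0 i x = (if i = j then 1 else 0)" for i using bspline_0_eq[OF _ j] by blast
  have "((\<lambda>i. bspline t 0 i x) has_sum (\<Sum>i\<in>{j}. bspline t 0 i x)) UNIV"
    by (rule has_sum_finite_neutralI[where B = "{j}"]) (use eq in \<open>auto simp del: bspline.simps\<close>)
  then show ?case by (simp add: eq del: bspline.simps)
next
  case (Suc k)
  have sm: "strict_mono t" using assms by (simp add: knot_sequence_def)
  define g where "g i = (x - t (i - int k)) / (t (i + 1) - t (i - int k)) * bspline t k i x" for i
  define S where "S = (\<Sum>i\<in>{i. bspline t k i x \<noteq> 0}. g i)"
  have g: "(g has_sum S) UNIV"
    unfolding S_def
    by (rule has_sum_finite_neutralI[where B = "{i. bspline t k i x \<noteq> 0}"])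
      (use finite_bspline_support[OF assms] in \<open>auto simp: g_def\<close>)
  have "bij_betw (\<lambda>i::int. i - 1) UNIV UNIV"
    by (rule bij_betwI[where g = "\<lambda>i. i + 1"]) auto
  from has_sum_reindex_bij_betw[OF this, of g S] g
  have g': "((\<lambda>i. g (i - 1)) has_sum S) UNIV" by simp
  have "((\<lambda>i. bspline t k i x - g i) has_sum 1 - S) UNIV"
    using has_sum_add[OF Suc has_sum_uminusI[OF g]] by simp
  from has_sum_add[OF g' this]
  have "((\<lambda>i. g (i - 1) + (bspline t k i x - g i)) has_sum 1) UNIV" by simp
  moreover have "g (i - 1) + (bspline t k i x - g i) = bspline t (Suc k) i x" for i
  proof -
    have "t (i - int k) < t (i + 1)" using sm by (simp add: strict_mono_less)
    then have "bspline t k i x - g i =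
        (t (i + 1) - x) / (t (i + 1) - t (i - int k)) * bspline t k i x"
      by (simp add: g_def field_simps)
    moreover have "i - 1 - int k = i - int (Suc k)" "i - 1 + 1 = i" by simp_all
    then have "g (i - 1) =
        (x - t (i - int (Suc k))) / (t i - t (i - int (Suc k))) * bspline t k (i - 1) x"
      by (simp only: g_def)
    ultimately show ?thesis by (simp only: bspline.simps)
  qed
  ultimately show ?case by (simp del: bspline.simps)
qed

lemma strict_mono_theta:
  assumes "strict_mono t" "0 < m"
  shows "strict_mono (theta t m)"
proof (rule strict_monoI)
  fix i j :: int assume "i < j"
  then have "(\<Sum>r<m. t (i - int r)) < (\<Sum>r<m. t (j - int r))"
    using assms by (intro sum_strict_mono) (auto simp: strict_mono_less)
  then show "theta t m i < theta t m j"
    using assms by (simp add: theta_def divide_strict_right_mono)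
qed

lemma lambda_system_ex1:
  assumes "strict_mono t" "0 < m" "0 < p"
  shows "\<exists>!l. lambda_system t m p i l"
proof -
  define u v w where "u = theta t m (i - p)" and "v = theta t m i" and "w = theta t m (i + p)"
  have uvw: "u < v" "v < w"
    using strict_mono_theta[OF assms(1,2)] assms(3)
    by (auto simp: u_def v_def w_def strict_mono_less)
  define e where "e = theta2 t m i - v\<^sup>2"
  define a where "a = e / ((v - u) * (w - u))"
  define c where "c = e / ((w - v) * (w - u))"
  have sys: "lambda_system t m p i (a', b', c') \<longleftrightarrow>
      a' = a \<and> b' = 1 - a - c \<and> c' = c" for a' b' c'
  proof -
    have "lambda_system t m p i (a', b', c') \<longleftrightarrow>
        b' = 1 - a' - c' \<and> (w - v) * c' = (v - u) * a' \<and>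
        (u\<^sup>2 - v\<^sup>2) * a' + (w\<^sup>2 - v\<^sup>2) * c' = e"
    proof -
      have "u * a' + v * b' + w * c' = v \<longleftrightarrow> (w - v) * c' = (v - u) * a'"
        "u\<^sup>2 * a' + v\<^sup>2 * b' + w\<^sup>2 * c' = theta2 t m i \<longleftrightarrow>
          (u\<^sup>2 - v\<^sup>2) * a' + (w\<^sup>2 - v\<^sup>2) * c' = e"
        if "b' = 1 - a' - c'"
        unfolding that e_def by (simp_all only: algebra_simps) linarith+
      moreover have "a' + b' + c' = 1 \<longleftrightarrow> b' = 1 - a' - c'" by linarith
      ultimately show ?thesis
        unfolding lambda_system_def u_def[symmetric] v_def[symmetric] w_def[symmetric] prod.case
        by blast
    qed
    also have "\<dots> \<longleftrightarrow> b' = 1 - a' - c' \<and> (w - v) * c' = (v - u) * a' \<and>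
        (v - u) * a' * (w - u) = e"
    proof -
      have "(u\<^sup>2 - v\<^sup>2) * a' + (w\<^sup>2 - v\<^sup>2) * c' = (v - u) * a' * (w - u)"
        if "(w - v) * c' = (v - u) * a'"
      proof -
        have "(u\<^sup>2 - v\<^sup>2) * a' + (w\<^sup>2 - v\<^sup>2) * c' =
            (w + v) * ((w - v) * c') - (u + v) * ((v - u) * a')"
          by (simp add: power2_eq_square algebra_simps)
        also have "\<dots> = (v - u) * a' * (w - u)" unfolding that by (simp add: algebra_simps)
        finally show ?thesis .
      qed
      then show ?thesis by auto
    qed
    also have "\<dots> \<longleftrightarrow> a' = a \<and> b' = 1 - a - c \<and> c' = c"
    proof -
      have ne: "(v - u) * (w - u) \<noteq> 0" "w - v \<noteq> 0" using uvw by auto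
      have "(v - u) * a' * (w - u) = e \<longleftrightarrow> a' * ((v - u) * (w - u)) = e"
        by (simp only: mult.commute mult.left_commute)
      also have "\<dots> \<longleftrightarrow> a' = a"
        unfolding a_def using nonzero_eq_divide_eq[OF ne(1)] by (rule sym)
      finally have A: "(v - u) * a' * (w - u) = e \<longleftrightarrow> a' = a" .
      have "(v - u) * a = e / (w - u)" "(w - v) * c = e / (w - u)"
        using uvw by (simp_all add: a_def c_def)
      then have C: "(w - v) * c' = (v - u) * a \<longleftrightarrow> c' = c"
        using ne(2) by (metis mult_cancel_left)
      show ?thesis using A C by blast
    qed
    finally show ?thesis .
  qed
  show ?thesis
  proof (rule ex1I)
    show "lambda_system t m p i (a, 1 - a - c, c)" unfolding sys by blast
    show "l = (a, 1 - a - c, c)" if "lambda_system t m p i l" for l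
      using that by (cases l) (simp only: sys)
  qed
qed

end

theory Submission
  imports Defs
begin

text \<open>
  Since the B-splines are nonnegative and sum to 1, \<open>Q_star t m p f x\<close> is a convex combination
  of the numbers \<open>mu_star t m p i f\<close>, so the norm of the operator is at most the supremum over
  \<open>i\<close> of \<open>\<bar>a\<bar> + \<bar>b\<bar> + \<bar>c\<bar>\<close>, where \<open>(a, b, c)\<close> solves the Vandermonde system.

  Write \<open>u < v < w\<close> for the three nodes and \<open>q\<close> for the second moment \<open>theta2 t m i\<close>. Solving the
  system centred at \<open>v\<close> shows that \<open>a\<close> and \<open>c\<close> have the sign of \<open>q - v\<^sup>2\<close> and that
  \<open>a + c = (q - v\<^sup>2) / ((v - u) * (w - v))\<close>. Newton's inequality makes this negative or zero, so
  that the sum of absolute values is \<open>1 + 2 * (v\<^sup>2 - q) / ((v - u) * (w - v))\<close>.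

  Expressing \<open>q\<close> by power sums gives \<open>(m - 1) * (v\<^sup>2 - q)\<close> as the variance of the \<open>m\<close>
  knots whose mean is \<open>v\<close>. For \<open>p \<ge> m\<close> the means \<open>u\<close> and \<open>w\<close> involve only knots to the left, and
  to the right, of these \<open>m\<close> knots, which therefore lie in \<open>[u, w]\<close>. The Bhatia--Davis inequality
  bounds the variance of numbers in \<open>[u, w]\<close> with mean \<open>v\<close> by \<open>(v - u) * (w - v)\<close>. The sum of
  absolute values is thus at most \<open>1 + 2 / (m - 1) = (m + 1) / (m - 1)\<close>.
\<close>

section \<open>Spline series with bounded coefficients\<close>

text \<open>
  The weights of the recursion are nonnegative only between the outermost knots, so positivity has
  to be proved together with the location of the support.
\<close>

lemma bspline_nonneg_and_support:
  assumes "strict_mono t"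
  shows "0 \<le> bspline t k i x \<and> (bspline t k i x \<noteq> 0 \<longrightarrow> t (i - int k) \<le> x \<and> x < t (i + 1))"
proof (induction k arbitrary: i)
  case 0
  then show ?case by simp
next
  case (Suc k)
  have knots: "t (i - int (Suc k)) < t (i - int k)" "t (i - int k) \<le> t i" "t i < t (i + 1)"
    using assms by (auto simp: strict_mono_less strict_mono_less_eq)
  have index: "i - 1 - int k = i - int (Suc k)" by simp
  have left: "0 \<le> bspline t k (i - 1) x"
    "bspline t k (i - 1) x \<noteq> 0 \<Longrightarrow> t (i - int (Suc k)) \<le> x \<and> x < t i"
    using Suc[of "i - 1"] unfolding index by auto
  have right: "0 \<le> bspline t k i x"
    "bspline t k i x \<noteq> 0 \<Longrightarrow> t (i - int k) \<le> x \<and> x < t (i + 1)"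
    using Suc[of i] by auto
  have "0 \<le> (x - t (i - int (Suc k))) / (t i - t (i - int (Suc k))) * bspline t k (i - 1) x"
    using left knots by (cases "bspline t k (i - 1) x = 0") auto
  moreover have "0 \<le> (t (i + 1) - x) / (t (i + 1) - t (i - int k)) * bspline t k i x"
    using right knots by (cases "bspline t k i x = 0") auto
  moreover have "t (i - int (Suc k)) \<le> x \<and> x < t (i + 1)" if "bspline t (Suc k) i x \<noteq> 0"
  proof -
    have "bspline t k (i - 1) x \<noteq> 0 \<or> bspline t k i x \<noteq> 0" using that by auto
    then show ?thesis using left(2) right(2) knots by linarith
  qed
  ultimately show ?case by (simp only: bspline.simps) simp
qed

lemma abs_spline_series_le:
  assumes "knot_sequence t" and "\<And>i. \<bar>c i\<bar> \<le> K"
  shows "\<bar>\<Sum>\<^sub>\<infinity>i. c i * bspline t m i x\<bar> \<le> K"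
proof -
  let ?F = "{i. bspline t m i x \<noteq> 0}"
  have fin: "finite ?F" by (rule finite_bspline_support[OF assms(1)])
  have nonneg: "0 \<le> bspline t m i x" for i
    using bspline_nonneg_and_support assms(1) by (simp add: knot_sequence_def)
  have "((\<lambda>i. bspline t m i x) has_sum (\<Sum>i\<in>?F. bspline t m i x)) UNIV"
    by (rule has_sum_finite_neutralI[OF fin]) auto
  then have one: "(\<Sum>i\<in>?F. bspline t m i x) = 1"
    using bspline_partition_of_unity[OF assms(1)] has_sum_unique by blast
  have "((\<lambda>i. c i * bspline t m i x) has_sum (\<Sum>i\<in>?F. c i * bspline t m i x)) UNIV"
    by (rule has_sum_finite_neutralI[OF fin]) auto
  then have "(\<Sum>\<^sub>\<infinity>i. c i * bspline t m i x) = (\<Sum>i\<in>?F. c i * bspline t m i x)"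
    by (rule infsumI)
  also have "\<bar>\<dots>\<bar> \<le> (\<Sum>i\<in>?F. \<bar>c i * bspline t m i x\<bar>)" by (rule sum_abs)
  also have "\<dots> \<le> (\<Sum>i\<in>?F. K * bspline t m i x)"
    using assms(2) nonneg by (intro sum_mono) (simp add: abs_mult mult_right_mono)
  also have "\<dots> = K" using one by (simp flip: sum_distrib_left)
  finally show ?thesis .
qed

section \<open>The variance of the knots\<close>

lemma square_sum_eq_sum_squares_plus_pairs:
  fixes x :: "nat \<Rightarrow> 'a :: comm_ring_1"
  shows "(\<Sum>r<m. x r)\<^sup>2 = (\<Sum>r<m. (x r)\<^sup>2) + 2 * (\<Sum>s<m. \<Sum>r<s. x r * x s)"
  by (induction m) (simp_all add: power2_eq_square algebra_simps sum_distrib_left sum_distrib_right)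

text \<open>
  Eliminating the sum over pairs of knots by means of the square of their sum leaves only power
  sums, and these combine to the variance of the knots averaged by \<open>theta t m i\<close>.
\<close>

lemma theta_square_minus_theta2:
  assumes "m \<ge> 2"
  shows "(real m - 1) * ((theta t m i)\<^sup>2 - theta2 t m i)
    = (\<Sum>r<m. (t (i - int r))\<^sup>2) / real m - (theta t m i)\<^sup>2"
proof -
  define S where "S = (\<Sum>r<m. t (i - int r))"
  define N where "N = (\<Sum>r<m. (t (i - int r))\<^sup>2)"
  define E where "E = (\<Sum>s<m. \<Sum>r<s. t (i - int r) * t (i - int s))"
  have sq: "S\<^sup>2 = N + 2 * E"
    unfolding S_def N_def E_def by (rule square_sum_eq_sum_squares_plus_pairs)
  have "even (m * (m - 1))" by (cases m) auto
  then have "2 * (m choose 2) = m * (m - 1)" unfolding choose_two by (rule dvd_mult_div_cancel)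
  then have "real (2 * (m choose 2)) = real (m * (m - 1))" by (rule arg_cong)
  then have "2 * real (m choose 2) = real m * (real m - 1)" using assms by (simp add: of_nat_diff)
  then have binom: "real (m choose 2) = real m * (real m - 1) / 2" by simp
  have m: "real m \<noteq> 0" "real m - 1 \<noteq> 0" using assms by auto
  have "(real m - 1) * theta2 t m i = (S\<^sup>2 - N) / real m"
    using m unfolding theta2_def E_def[symmetric] binom sq by (simp add: field_simps)
  moreover have "real m * (theta t m i)\<^sup>2 = S\<^sup>2 / real m"
    using m by (simp add: theta_def S_def power2_eq_square)
  ultimately show ?thesis
    unfolding N_def[symmetric] by (simp add: algebra_simps diff_divide_distrib)
qed

lemma variance_nonneg:
  fixes x :: "nat \<Rightarrow> real"
  assumes "m > 0" and v: "v = (\<Sum>r<m. x r) / real m"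
  shows "0 \<le> (\<Sum>r<m. (x r)\<^sup>2) / real m - v\<^sup>2"
proof -
  have S: "(\<Sum>r<m. x r) = real m * v" using assms by simp
  have "0 \<le> (\<Sum>r<m. (x r - v)\<^sup>2)" by (simp add: sum_nonneg)
  also have "\<dots> = (\<Sum>r<m. (x r)\<^sup>2 - 2 * v * x r + v\<^sup>2)"
    by (simp add: power2_eq_square algebra_simps)
  also have "\<dots> = (\<Sum>r<m. (x r)\<^sup>2) - real m * v\<^sup>2"
    by (simp add: sum.distrib sum_subtractf S power2_eq_square flip: sum_distrib_left)
  finally show ?thesis using assms(1) by (simp add: field_simps)
qed

text \<open>
  This holds because the average of the nonnegative numbers \<open>(x r - u) * (w - x r)\<close>
  is the difference of the two sides.
\<close>

lemma variance_le_Bhatia_Davis: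
  fixes x :: "nat \<Rightarrow> real"
  assumes "m > 0" and v: "v = (\<Sum>r<m. x r) / real m"
    and "\<And>r. r < m \<Longrightarrow> u \<le> x r" and "\<And>r. r < m \<Longrightarrow> x r \<le> w"
  shows "(\<Sum>r<m. (x r)\<^sup>2) / real m - v\<^sup>2 \<le> (v - u) * (w - v)"
proof -
  have S: "(\<Sum>r<m. x r) = real m * v" using assms by simp
  have "0 \<le> (\<Sum>r<m. (x r - u) * (w - x r))"
    using assms(3,4) by (intro sum_nonneg mult_nonneg_nonneg) auto
  also have "\<dots> = (\<Sum>r<m. (u + w) * x r - (x r)\<^sup>2 - u * w)"
    by (simp add: power2_eq_square algebra_simps)
  also have "\<dots> = (u + w) * (real m * v) - (\<Sum>r<m. (x r)\<^sup>2) - real m * (u * w)"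
    by (simp add: sum_subtractf S flip: sum_distrib_left)
  finally have "(\<Sum>r<m. (x r)\<^sup>2) \<le> real m * ((u + w) * v - u * w)"
    by (simp add: algebra_simps)
  then have "(\<Sum>r<m. (x r)\<^sup>2) / real m \<le> (u + w) * v - u * w"
    using assms(1) by (simp add: divide_le_eq mult.commute)
  then show ?thesis by (simp add: power2_eq_square algebra_simps)
qed

lemma theta_shift_bounds:
  assumes "strict_mono t" "r < m" "int m \<le> p"
  shows "theta t m (i - p) \<le> t (i - int r)" "t (i - int r) \<le> theta t m (i + p)"
proof -
  have "(\<Sum>s<m. t (i - p - int s)) \<le> of_nat (card {..<m}) * t (i - int r)"
    using assms by (intro sum_bounded_above) (simp add: strict_mono_less_eq)
  then show "theta t m (i - p) \<le> t (i - int r)"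
    using assms(2) by (simp add: theta_def divide_le_eq mult.commute)
  have "of_nat (card {..<m}) * t (i - int r) \<le> (\<Sum>s<m. t (i + p - int s))"
    using assms by (intro sum_bounded_below) (simp add: strict_mono_less_eq)
  then show "t (i - int r) \<le> theta t m (i + p)"
    using assms(2) by (simp add: theta_def le_divide_eq mult.commute)
qed

section \<open>The coefficient functionals\<close>

lemma vandermonde3_abs_sum_le:
  fixes a b c q u v w K :: real
  assumes "u < v" "v < w"
    and sum: "a + b + c = 1"
    and first: "u * a + v * b + w * c = v"
    and second: "u\<^sup>2 * a + v\<^sup>2 * b + w\<^sup>2 * c = q"
    and "q \<le> v\<^sup>2" and K: "v\<^sup>2 - q \<le> K * ((v - u) * (w - v))"
  shows "\<bar>a\<bar> + \<bar>b\<bar> + \<bar>c\<bar> \<le> 1 + 2 * K"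
proof -
  define d where "d = a * (v - u)"
  have b: "b = 1 - a - c" using sum by simp
  have dc: "d = c * (w - v)" using first unfolding b d_def by (simp add: algebra_simps)
  \<comment> \<open>The second moment about \<open>v\<close>: the equations of order 0 and 1 turn \<open>q\<close> into \<open>q - v\<^sup>2\<close>.\<close>
  have "a * (v - u)\<^sup>2 + c * (w - v)\<^sup>2 =
      (u\<^sup>2 * a + v\<^sup>2 * b + w\<^sup>2 * c) - 2 * v * (u * a + v * b + w * c) + v\<^sup>2 * (a + b + c)"
    by (simp add: power2_eq_square algebra_simps)
  also have "\<dots> = q - v\<^sup>2" unfolding sum first second by (simp add: power2_eq_square)
  finally have "a * (v - u)\<^sup>2 + c * (w - v)\<^sup>2 = q - v\<^sup>2" .
  moreover have "a * (v - u)\<^sup>2 = d * (v - u)" by (simp add: d_def power2_eq_square)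
  moreover have "c * (w - v)\<^sup>2 = d * (w - v)" by (simp add: dc power2_eq_square)
  ultimately have dq: "d * (v - u) + d * (w - v) = q - v\<^sup>2" by simp
  then have "d * (w - u) \<le> 0" using \<open>q \<le> v\<^sup>2\<close> by (simp add: algebra_simps)
  then have "d \<le> 0" using assms(1,2) by (simp add: mult_le_0_iff)
  have "a \<le> 0" using \<open>d \<le> 0\<close> \<open>u < v\<close> unfolding d_def by (simp add: mult_le_0_iff)
  have "c \<le> 0" using \<open>d \<le> 0\<close> \<open>v < w\<close> unfolding dc by (simp add: mult_le_0_iff)
  have "(a + c) * ((v - u) * (w - v)) = a * (v - u) * (w - v) + c * (w - v) * (v - u)"
    by (simp add: algebra_simps)
  also have "\<dots> = q - v\<^sup>2" using dq unfolding d_def[symmetric] dc[symmetric] by simp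
  finally have "- (a + c) * ((v - u) * (w - v)) = v\<^sup>2 - q"
    by (simp only: mult_minus_left minus_diff_eq)
  with K have "- (a + c) * ((v - u) * (w - v)) \<le> K * ((v - u) * (w - v))" by (simp only:)
  then have "- (a + c) \<le> K" using assms(1,2)
    by (simp only: mult_le_cancel_right_pos mult_pos_pos diff_gt_0_iff_gt)
  then show ?thesis using b \<open>a \<le> 0\<close> \<open>c \<le> 0\<close> by linarith
qed

lemma lambda_star_abs_sum_le:
  assumes "m \<ge> 2" "int m \<le> p" "strict_mono t" and abc: "lambda_star t m p i = (a, b, c)"
  shows "\<bar>a\<bar> + \<bar>b\<bar> + \<bar>c\<bar> \<le> (real m + 1) / (real m - 1)"
proof -
  let ?u = "theta t m (i - p)" and ?v = "theta t m i" and ?w = "theta t m (i + p)"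
  let ?var = "(\<Sum>r<m. (t (i - int r))\<^sup>2) / real m - ?v\<^sup>2"
  have m: "0 < m" "real m - 1 > 0" and "0 < p" using assms(1,2) by auto
  have "lambda_system t m p i (a, b, c)"
    using theI'[OF lambda_system_ex1[OF assms(3) m(1) \<open>0 < p\<close>]] abc
    by (metis lambda_star_def)
  then have sys: "a + b + c = 1" "?u * a + ?v * b + ?w * c = ?v"
      "?u\<^sup>2 * a + ?v\<^sup>2 * b + ?w\<^sup>2 * c = theta2 t m i"
    by (simp_all add: lambda_system_def)
  have order: "?u < ?v" "?v < ?w"
    using strict_mono_theta[OF assms(3) m(1)] \<open>0 < p\<close> by (simp_all add: strict_mono_less)
  have var: "?v\<^sup>2 - theta2 t m i = ?var / (real m - 1)"
    using theta_square_minus_theta2[OF assms(1), of t i] m by (simp add: field_simps)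
  have "0 \<le> ?var" by (rule variance_nonneg[OF m(1)]) (simp add: theta_def)
  then have "0 \<le> ?var / (real m - 1)" using m by (intro divide_nonneg_pos)
  then have newton: "theta2 t m i \<le> ?v\<^sup>2" using var by linarith
  have "?var \<le> (?v - ?u) * (?w - ?v)"
    by (rule variance_le_Bhatia_Davis[OF m(1)])
      (use theta_shift_bounds[OF assms(3) _ assms(2)] in \<open>auto simp: theta_def\<close>)
  then have "?v\<^sup>2 - theta2 t m i \<le> 1 / (real m - 1) * ((?v - ?u) * (?w - ?v))"
    unfolding var using m by (simp add: divide_right_mono)
  from vandermonde3_abs_sum_le[OF order sys newton this]
  have "\<bar>a\<bar> + \<bar>b\<bar> + \<bar>c\<bar> \<le> 1 + 2 * (1 / (real m - 1))" .
  also have "\<dots> = (real m + 1) / (real m - 1)" using m by (simp add: field_simps)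
  finally show ?thesis .
qed

lemma abs_mu_star_le:
  assumes "m \<ge> 2" "int m \<le> p" "strict_mono t" and f: "\<And>x. \<bar>f x\<bar> \<le> 1"
  shows "\<bar>mu_star t m p i f\<bar> \<le> (real m + 1) / (real m - 1)"
proof -
  obtain a b c where abc: "lambda_star t m p i = (a, b, c)" by (cases "lambda_star t m p i")
  have le: "\<bar>y * f x\<bar> \<le> \<bar>y\<bar>" for x y
    using mult_left_le[OF f[of x], of "\<bar>y\<bar>"] by (simp add: abs_mult)
  have "\<bar>mu_star t m p i f\<bar> \<le> \<bar>a\<bar> + \<bar>b\<bar> + \<bar>c\<bar>"
    using le[of a "theta t m (i - p)"] le[of b "theta t m i"] le[of c "theta t m (i + p)"]
    unfolding mu_star_def abc prod.case by linarith
  also have "\<dots> \<le> (real m + 1) / (real m - 1)" by (rule lambda_star_abs_sum_le[OF assms(1-3) abc])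
  finally show ?thesis .
qed

theorem theorem5:
  fixes m :: nat
  assumes "m \<ge> 2"
  shows "(\<forall>(p::int) (t::int \<Rightarrow> real). p \<ge> int m \<longrightarrow> knot_sequence t \<longrightarrow>
            op_sup_norm (Q_star t m p) \<le> ereal ((real m + 1) / (real m - 1)))
       \<and> (\<exists>C::real. \<forall>(p::int) (t::int \<Rightarrow> real). p \<ge> int m \<longrightarrow> knot_sequence t \<longrightarrow>
            op_sup_norm (Q_star t m p) \<le> ereal C)"
proof -
  have "op_sup_norm (Q_star t m p) \<le> ereal ((real m + 1) / (real m - 1))"
    if p: "int m \<le> p" and t: "knot_sequence t" for p t
    unfolding op_sup_norm_def
  proof (rule SUP_least)
    fix f :: "real \<Rightarrow> real"
    assume "f \<in> {f. continuous_on UNIV f \<and> bounded (range f) \<and> sup_norm f \<le> 1}"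
    then have "sup_norm f \<le> 1" by simp
    then have f: "\<bar>f x\<bar> \<le> 1" for x by (simp add: sup_norm_def SUP_le_iff)
    have "strict_mono t" using t by (simp add: knot_sequence_def)
    then have "\<bar>Q_star t m p f x\<bar> \<le> (real m + 1) / (real m - 1)" for x
      unfolding Q_star_def by (intro abs_spline_series_le[OF t] abs_mu_star_le[OF assms p] f)
    then show "sup_norm (Q_star t m p f) \<le> ereal ((real m + 1) / (real m - 1))"
      unfolding sup_norm_def by (intro SUP_least) simp
  qed
  then show ?thesis by blast
qed

end
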